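(* Fix an integer $d\ge1$ and a field $\mathbb{F}\in\{\mathbb{R},\mathbb{C}\}$. There are Borel prediction rules $\Phi_N:(\mathbb{R}^{d\times d})^N\to\{0,1\}$, $N\ge1$ (not depending on the underlying law), such that, for every law on $\mathbb{R}^{d\times d}$ supported on $[0,1]^{d\times d}$, if $X_1,X_2,\ldots$ are i.i.d. random matrices with this law and $M=\mathbb{E}X_1$ is the entrywise mean, then $$\mathbb{P}\left(\Phi_N(X_1,\ldots,X_N)=\mathbf{1}\{M\in\mathcal{D}_{\mathbb{F},d}\}\text{ for all sufficiently large }N\right)=1.$$ In particular, this holds for all i.i.d. sequences of random binary matrices, i.e. with $X_1\in\{0,1\}^{d\times d}$ almost surely.
   Context: For $\mathbb{F}\in\{\mathbb{R},\mathbb{C}\}$, $\mathcal{D}_{\mathbb{F},d}\subseteq\mathbb{R}^{d\times d}$ denotes the set of real $d\times d$ matrices that are diagonalizable over $\mathbb{F}$, i.e. similar over $\mathbb{F}$ to a diagonal matrix with entries in $\mathbb{F}$. The matrices $X_i$ are independent across $i$, but the entries of a single $X_i$ may be arbitrarily dependent. *)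

theory Defs
  imports "HOL-Probability.Probability"
begin

(* The scalar field is the type parameter 'f, used at 'f = real and 'f = complex;
   the matrix itself is always real and is read over 'f through of_real. *)
definition diagonalizable_matrices :: "'f::real_field itself \<Rightarrow> (real^'n^'n) set" where
  "diagonalizable_matrices F =
     {A. \<exists>P D :: 'f^'n^'n.
           invertible P \<and> (\<forall>i j. i \<noteq> j \<longrightarrow> D $ i $ j = 0) \<and>
           (\<chi> i j. of_real (A $ i $ j)) = P ** D ** matrix_inv P}"

definition entries_in :: "real set \<Rightarrow> (real^'n^'n) set" where
  "entries_in E = {A. \<forall>i j. A $ i $ j \<in> E}"

definition iid_with_law ::
  "'w measure \<Rightarrow> (nat \<Rightarrow> 'w \<Rightarrow> real^'n^'n) \<Rightarrow> (real^'n^'n) measure \<Rightarrow> bool" where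
  "iid_with_law \<Omega> X \<mu> \<longleftrightarrow>
     prob_space \<Omega> \<and> prob_space.indep_vars \<Omega> (\<lambda>_. borel) X UNIV \<and>
     (\<forall>i. distr \<Omega> borel (X i) = \<mu>)"

definition entrywise_mean :: "'w measure \<Rightarrow> ('w \<Rightarrow> real^'n^'n) \<Rightarrow> real^'n^'n" where
  "entrywise_mean \<Omega> Y = (\<chi> i j. prob_space.expectation \<Omega> (\<lambda>\<omega>. Y \<omega> $ i $ j))"

(* A point of (R^(d x d))^N is a function on {..<N}, extended by undefined as in PiM. *)
definition borel_prediction_rules ::
  "(nat \<Rightarrow> (nat \<Rightarrow> real^'n^'n) \<Rightarrow> nat) \<Rightarrow> bool" where
  "borel_prediction_rules \<Phi> \<longleftrightarrow>
     (\<forall>N\<ge>1. \<Phi> N \<in> (\<Pi>\<^sub>M i\<in>{..<N}. borel) \<rightarrow>\<^sub>M count_space {0, 1})"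

(* The sample X_1, ..., X_N is indexed from 0, as X 0, ..., X (N - 1). *)
definition eventually_correct ::
  "(real^'n^'n) set \<Rightarrow> (nat \<Rightarrow> (nat \<Rightarrow> real^'n^'n) \<Rightarrow> nat) \<Rightarrow>
   'w measure \<Rightarrow> (nat \<Rightarrow> 'w \<Rightarrow> real^'n^'n) \<Rightarrow> bool" where
  "eventually_correct S \<Phi> \<Omega> X \<longleftrightarrow>
     \<P>(\<omega> in \<Omega>. \<forall>\<^sub>F N in sequentially.
          \<Phi> N (\<lambda>i\<in>{..<N}. X i \<omega>) = of_bool (entrywise_mean \<Omega> (X 0) \<in> S)) = 1"

end

theory Submission
  imports Defs "HOL-Computational_Algebra.Fundamental_Theorem_Algebra" "HOL-Real_Asymp.Real_Asymp"
begin

text \<open>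
  Whether a mean lies in a set \<open>S\<close> can be decided in the limit as soon as \<open>S\<close> and its complement are
  both increasing unions of closed sets, \<open>S = (\<Union>k. K k)\<close> and \<open>- S = (\<Union>k. L k)\<close>. Sample means of
  matrices with entries in \<open>[0,1]\<close> are almost surely within \<open>N powr (- (1/4))\<close> of the true mean \<open>M\<close> for
  all large \<open>N\<close>, by Hoeffding's inequality and the Borel-Cantelli lemma. The rule answers 1 if, for some
  \<open>k\<close>, the sample mean is that close to \<open>K k\<close> but not to \<open>L k\<close>. If \<open>M \<in> K k\<close>, then \<open>M\<close> has positive distance
  from the closed set \<open>L k\<close>, so \<open>k\<close> is eventually a witness. If \<open>M \<in> L k\<close>, then no index \<open>j \<ge> k\<close> can be a
  witness because \<open>L k \<subseteq> L j\<close>, and eventually no index \<open>j \<le> k\<close> can be one because \<open>K j \<subseteq> K k\<close> and \<open>M\<close> has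
  positive distance from \<open>K k\<close> (\<open>closeness_rule_eventually_correct\<close>).

  It remains to see that the diagonalizable matrices and the non-diagonalizable ones are such unions.
  A projection of a closed subset of a Euclidean space is an increasing union of compact sets, so both
  properties need only be witnessed existentially by closed conditions. Diagonalizability is
  witnessed by the factors \<open>A = P ** D ** Q\<close> with \<open>P ** Q = mat 1\<close> and \<open>D\<close> diagonal. For the complement the
  witness is algebraic: over \<open>\<complex>\<close> a matrix is not diagonalizable iff it has a generalized eigenvector,
  \<open>(A - a)\<^sup>2 v = 0\<close> but \<open>(A - a) v \<noteq> 0\<close>; over \<open>\<real>\<close> it may also fail to be so because of a
  non-real eigenvalue, and then some quadratic \<open>(A - a)\<^sup>2 + c\<close> with \<open>c > 0\<close> has a nonzero kernel. Both are
  instances of one criterion (\<open>diagonalizable_iff_no_obstruction\<close>): \<open>A\<close> is diagonalizable iff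
  \<open>((A - a)\<^sup>2 + c) v = 0\<close> implies \<open>(A - a) v = 0\<close>, with \<open>c\<close> ranging over \<open>{0}\<close> in the complex case and over
  \<open>{0..}\<close> in the real case. It is proved by showing that the span \<open>W\<close> of the eigenvectors is everything:
  each \<open>v\<close> has a nonzero polynomial \<open>p\<close> with \<open>p(A) v \<in> W\<close>, and the factors of \<open>p\<close>, linear or of the form
  \<open>(x - a)\<^sup>2 + c\<close>, can be removed one at a time.
\<close>

section \<open>Diagonalizability and quadratic polynomials in a matrix\<close>

definition eigen_shift :: "'f::field^'n^'n \<Rightarrow> 'f \<Rightarrow> 'f^'n \<Rightarrow> 'f^'n" where
  "eigen_shift A a v = A *v v - a *s v"

definition shift_quadratic :: "'f::field^'n^'n \<Rightarrow> 'f \<Rightarrow> 'f \<Rightarrow> 'f^'n \<Rightarrow> 'f^'n" where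
  "shift_quadratic A a c v = eigen_shift A a (eigen_shift A a v) + c *s v"

lemma eigen_shift_diff: "eigen_shift A a (u - v) = eigen_shift A a u - eigen_shift A a v"
  by (simp add: eigen_shift_def matrix_vector_mult_diff_distrib vec.scale_right_diff_distrib)

lemma eigen_shift_add: "eigen_shift A a (u + v) = eigen_shift A a u + eigen_shift A a v"
  by (simp add: eigen_shift_def matrix_vector_right_distrib vec.scale_right_distrib)

lemma eigen_shift_scale: "eigen_shift A a (r *s v) = r *s eigen_shift A a v"
  by (simp add: eigen_shift_def vector_scalar_commute vec.scale_right_diff_distrib vec.scale_left_commute)

lemma shift_quadratic_diff:
  "shift_quadratic A a c (u - v) = shift_quadratic A a c u - shift_quadratic A a c v"
  by (simp add: shift_quadratic_def eigen_shift_diff vec.scale_right_diff_distrib)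

lemma shift_quadratic_add:
  "shift_quadratic A a c (u + v) = shift_quadratic A a c u + shift_quadratic A a c v"
  by (simp add: shift_quadratic_def eigen_shift_add vec.scale_right_distrib)

lemma shift_quadratic_scale:
  "shift_quadratic A a c (r *s v) = r *s shift_quadratic A a c v"
  by (simp add: shift_quadratic_def eigen_shift_scale vec.scale_right_distrib vec.scale_left_commute)

lemma shift_quadratic_eigen_shift:
  "shift_quadratic A a c (eigen_shift A a v) = eigen_shift A a (shift_quadratic A a c v)"
  by (simp add: shift_quadratic_def eigen_shift_add eigen_shift_scale)

text \<open>
  The zero vector is included, which is harmless because only the span of this set matters.
\<close>

definition eigenvectors :: "'f::field^'n^'n \<Rightarrow> ('f^'n) set" where
  "eigenvectors A = {v. \<exists>\<mu>. A *v v = \<mu> *s v}"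

text \<open>
  The vector \<open>p(A) v\<close>, evaluated by Horner's scheme. Square matrices with \<open>**\<close> are not an instance of a
  ring class, so \<open>poly\<close> cannot be applied to a matrix.
\<close>

definition poly_act :: "'f::field^'n^'n \<Rightarrow> 'f poly \<Rightarrow> 'f^'n \<Rightarrow> 'f^'n" where
  "poly_act A p v = fold_coeffs (\<lambda>a w. a *s v + A *v w) p 0"

lemma poly_act_0 [simp]: "poly_act A 0 v = 0"
  by (simp add: poly_act_def)

lemma poly_act_pCons [simp]: "poly_act A (pCons a p) v = a *s v + A *v poly_act A p v"
  by (cases "p = 0 \<and> a = 0") (auto simp: poly_act_def)

lemma poly_act_add: "poly_act A (p + q) v = poly_act A p v + poly_act A q v"
  by (induction p q rule: poly_induct2)
     (simp_all add: matrix_vector_right_distrib vec.scale_left_distrib algebra_simps)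

lemma poly_act_smult: "poly_act A (smult a p) v = a *s poly_act A p v"
  by (induction p)
     (simp_all add: vec.scale_right_distrib vector_scalar_commute)

lemma poly_act_mult: "poly_act A (p * q) v = poly_act A p (poly_act A q v)"
  by (induction p) (simp_all add: poly_act_add poly_act_smult)

lemma poly_act_monom: "poly_act A (monom c i) v = c *s ((*v) A ^^ i) v"
  by (induction i) (simp_all add: monom_Suc monom_0 vector_scalar_commute)

lemma poly_act_sum: "poly_act A (sum f S) v = (\<Sum>i\<in>S. poly_act A (f i) v)"
  by (induction S rule: infinite_finite_induct) (simp_all add: poly_act_add)

lemma poly_act_linear_factor: "poly_act A [:-\<mu>, 1:] v = eigen_shift A \<mu> v"
  by (simp add: eigen_shift_def vec.scale_left_distrib)

lemma poly_act_quadratic_factor: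
  "poly_act A [:a * a + c, - 2 * a, 1:] v = shift_quadratic A a c v"
proof -
  have "[:a * a + c, - 2 * a, 1:] = [:-a, 1:] * [:-a, 1:] + [:c:]"
    by (simp add: algebra_simps)
  then show ?thesis
    by (simp only: poly_act_add poly_act_mult poly_act_linear_factor shift_quadratic_def) simp
qed

text \<open>
  The \<open>CARD('n) + 1\<close> vectors \<open>v, A v, A\<^sup>2 v, \<dots>\<close> cannot be linearly independent: either two of them
  coincide or they form a dependent set, and each alternative gives a polynomial.
\<close>

lemma annihilating_poly_exists:
  fixes A :: "'f::field^'n^'n"
  shows "\<exists>p. p \<noteq> 0 \<and> poly_act A p v = 0"
proof (cases "inj_on (\<lambda>i. ((*v) A ^^ i) v) {..CARD('n)}")
  case False
  then obtain i j where ij: "i \<noteq> j" "((*v) A ^^ i) v = ((*v) A ^^ j) v"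
    by (auto simp: inj_on_def)
  let ?p = "monom 1 i + smult (-1) (monom 1 j) :: 'f poly"
  have "coeff ?p i = 1"
    using ij by simp
  have "?p \<noteq> 0"
  proof
    assume "?p = 0"
    then have "coeff ?p i = 0" by (simp only: coeff_0)
    with \<open>coeff ?p i = 1\<close> show False by simp
  qed
  moreover have "poly_act A ?p v = 0"
    by (simp only: poly_act_add poly_act_smult poly_act_monom ij(2)) simp
  ultimately show ?thesis by (intro exI[of _ ?p] conjI)
next
  case True
  let ?f = "\<lambda>i. ((*v) A ^^ i) v"
  have "vec.dependent (?f ` {..CARD('n)})"
  proof (rule vec.dependent_biggerset_general)
    have "vec.dim (?f ` {..CARD('n)}) \<le> vec.dim (UNIV :: ('f^'n) set)"
      by (rule vec.dim_subset) simp
    then have "vec.dim (?f ` {..CARD('n)}) \<le> CARD('n)"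
      by (simp only: vec_dim_card)
    then show "vec.dim (?f ` {..CARD('n)}) < card (?f ` {..CARD('n)})"
      using True by (simp add: card_image)
  qed
  then obtain u where u: "\<exists>w\<in>?f ` {..CARD('n)}. u w \<noteq> 0"
    "(\<Sum>w\<in>?f ` {..CARD('n)}. u w *s w) = 0"
    by (subst (asm) vec.dependent_finite) auto
  let ?p = "\<Sum>i\<le>CARD('n). monom (u (?f i)) i"
  have "(\<Sum>i\<le>CARD('n). u (?f i) *s ?f i) = 0"
    using u(2) True by (simp add: sum.reindex)
  then have "poly_act A ?p v = 0"
    by (simp add: poly_act_sum poly_act_monom)
  moreover obtain i where i: "i \<le> CARD('n)" "u (?f i) \<noteq> 0"
    using u(1) by auto
  have "coeff ?p i = u (?f i)"
    using i by (simp add: coeff_sum coeff_monom if_distrib cong: if_cong)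
  then have "?p \<noteq> 0"
    using i by force
  ultimately show ?thesis by blast
qed

definition diagonalizable :: "'f::field^'n^'n \<Rightarrow> bool" where
  "diagonalizable A \<longleftrightarrow> (\<exists>P D :: 'f^'n^'n. invertible P \<and> (\<forall>i j. i \<noteq> j \<longrightarrow> D $ i $ j = 0) \<and>
     A = P ** D ** matrix_inv P)"

lemma matrix_inv_eqI:
  fixes P Q :: "'f::field^'n^'n"
  assumes "P ** Q = mat 1"
  shows "matrix_inv P = Q"
proof -
  have "P ** Q = mat 1 \<and> Q ** P = mat 1"
    using assms by (metis matrix_left_right_inverse)
  then have "P ** matrix_inv P = mat 1 \<and> matrix_inv P ** P = mat 1"
    unfolding matrix_inv_def by (rule someI)
  then show ?thesis
    using assms by (metis matrix_mul_assoc matrix_mul_lid matrix_mul_rid)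
qed

text \<open>
  One equation \<open>P ** Q = mat 1\<close> replaces invertibility, which is not a closed condition, and the partial
  operation \<open>matrix_inv\<close>. Diagonalizability thereby becomes solvability of polynomial equations.
\<close>

lemma diagonalizable_iff_similar:
  fixes A :: "'f::field^'n^'n"
  shows "diagonalizable A \<longleftrightarrow> (\<exists>P Q D :: 'f^'n^'n. P ** Q = mat 1 \<and>
     (\<forall>i j. i \<noteq> j \<longrightarrow> D $ i $ j = 0) \<and> A = P ** D ** Q)"
proof -
  have "invertible P \<longleftrightarrow> (\<exists>Q. P ** Q = mat 1)" for P :: "'f^'n^'n"
    unfolding invertible_def by (metis matrix_left_right_inverse)
  then show ?thesis
    unfolding diagonalizable_def by (metis matrix_inv_eqI)
qed

text \<open>
  A basis chosen among the eigenvectors supplies the columns of \<open>P\<close>.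
\<close>

lemma diagonalizable_if_eigenvectors_span:
  fixes A :: "'f::field^'n^'n"
  assumes "vec.span (eigenvectors A) = UNIV"
  shows "diagonalizable A"
proof -
  obtain B where B: "B \<subseteq> eigenvectors A" "vec.independent B" "eigenvectors A \<subseteq> vec.span B"
    using vec.maximal_independent_subset[of "eigenvectors A"] by blast
  have span: "vec.span B = UNIV"
    using assms B(3) vec.span_minimal[OF B(3) vec.subspace_span] by auto
  have "finite B" using B(2) vec.finiteI_independent by blast
  moreover have "card B = CARD('n)"
    using B(2) span by (metis vec.dim_span vec.dim_eq_card_independent vec_dim_card)
  ultimately obtain b where b: "bij_betw b (UNIV :: 'n set) B"
    by (metis finite_same_card_bij finite)
  have "\<forall>j. \<exists>\<mu>. A *v b j = \<mu> *s b j"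
    using B(1) b by (auto simp: eigenvectors_def bij_betw_def)
  then obtain \<mu> where \<mu>: "\<And>j. A *v b j = \<mu> j *s b j" by metis
  define P where "P = (\<chi> i j. b j $ i)"
  define D where "D = (\<chi> i j. if i = j then \<mu> j else 0)"
  have "column j P = b j" for j by (simp add: column_def P_def vec_eq_iff)
  then have "columns P = B" using b by (auto simp: columns_def bij_betw_def)
  then obtain Q where PQ: "P ** Q = mat 1"
    using span by (metis matrix_right_invertible_span_columns)
  have "A ** P = P ** D"
  proof -
    have "(A ** P) $ i $ j = (P ** D) $ i $ j" for i j
    proof -
      have "(A ** P) $ i $ j = (A *v b j) $ i"
        by (simp add: matrix_matrix_mult_def matrix_vector_mult_def P_def)
      then show ?thesis
        by (simp add: \<mu> matrix_matrix_mult_def P_def D_def if_distrib cong: if_cong)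
    qed
    then show ?thesis by (simp add: vec_eq_iff)
  qed
  then have "A = P ** D ** Q"
    using PQ by (metis matrix_mul_assoc matrix_mul_rid)
  moreover have "\<forall>i j. i \<noteq> j \<longrightarrow> D $ i $ j = 0" by (simp add: D_def)
  ultimately show ?thesis
    using PQ unfolding diagonalizable_iff_similar by blast
qed

text \<open>
  The admissible constants \<open>c\<close> in the quadratics \<open>(x - a)\<^sup>2 + c\<close>. Definiteness says that such a quadratic
  has no root other than \<open>a\<close>, and that one only for \<open>c = 0\<close>, so a diagonal matrix meets no obstruction; the last
  assumption says that these quadratics and the linear polynomials suffice to factor every polynomial.
\<close>

locale definite_shifts =
  fixes C :: "'f::field set"
  assumes zero_shift: "0 \<in> C"
    and definite: "\<And>c x. c \<in> C \<Longrightarrow> x * x + c = 0 \<Longrightarrow> x = 0"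
    and has_factor: "\<And>p. degree p > 0 \<Longrightarrow> (\<exists>a. [:-a, 1:] dvd p) \<or>
      (\<exists>a. \<exists>c\<in>C. [:a * a + c, - 2 * a, 1:] dvd p)"
begin

text \<open>
  For \<open>c = 0\<close> this excludes generalized eigenvectors that are not eigenvectors. For \<open>c \<noteq> 0\<close> the conclusion
  \<open>(A - a) v = 0\<close> forces \<open>c v = 0\<close>, so it excludes a nonzero kernel of \<open>(A - a)\<^sup>2 + c\<close>.
\<close>

definition no_obstruction :: "'f^'n^'n \<Rightarrow> bool" where
  "no_obstruction A \<longleftrightarrow>
     (\<forall>a v. \<forall>c\<in>C. shift_quadratic A a c v = 0 \<longrightarrow> eigen_shift A a v = 0)"

text \<open>
  Write \<open>q\<close> for the polynomial \<open>(x - a)\<^sup>2 + c\<close>. On an eigenvector with eigenvalue \<open>\<mu>\<close> the map \<open>q(A)\<close> is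
  multiplication by \<open>q(\<mu>)\<close>. If \<open>q(\<mu>) \<noteq> 0\<close>, then the eigenvector is a value of \<open>q(A)\<close> on the span; otherwise
  \<open>\<mu> = a\<close> and \<open>c = 0\<close>, and the eigenvector is a possible \<open>w\<close>. Sums of such decompositions are again of this form.
\<close>

lemma span_eigenvectors_decomposition:
  assumes c: "c \<in> C" and u: "u \<in> vec.span (eigenvectors A)"
  shows "\<exists>y w. y \<in> vec.span (eigenvectors A) \<and> eigen_shift A a w = 0 \<and> c *s w = 0 \<and>
    u = shift_quadratic A a c y + w"
proof -
  let ?T = "{shift_quadratic A a c y + w |y w.
    y \<in> vec.span (eigenvectors A) \<and> eigen_shift A a w = 0 \<and> c *s w = 0}"
  have T_I: "x \<in> ?T" if "x = shift_quadratic A a c y + w" "y \<in> vec.span (eigenvectors A)"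
    "eigen_shift A a w = 0" "c *s w = 0" for x y w
    using that by blast
  have "vec.span (eigenvectors A) \<subseteq> ?T"
  proof (rule vec.span_minimal)
    show "eigenvectors A \<subseteq> ?T"
    proof
      fix e assume e: "e \<in> eigenvectors A"
      then obtain \<mu> where \<mu>: "A *v e = \<mu> *s e"
        by (auto simp: eigenvectors_def)
      let ?q = "(\<mu> - a) * (\<mu> - a) + c"
      have sh: "eigen_shift A a e = (\<mu> - a) *s e"
        by (simp add: eigen_shift_def \<mu> vec.scale_left_diff_distrib)
      then have q: "shift_quadratic A a c e = ?q *s e"
        by (simp only: shift_quadratic_def eigen_shift_scale vec.scale_left_distrib vec.scale_scale)
      show "e \<in> ?T"
      proof (cases "?q = 0")
        case True
        then have *: "\<mu> - a = 0"
          using definite[OF c] by blast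
        with True have "c = 0" by simp
        then show ?thesis
          using sh * by (intro T_I[of e 0 e]) (auto simp: shift_quadratic_def eigen_shift_def vec.span_zero)
      next
        case False
        have "shift_quadratic A a c (inverse ?q *s e) = e"
          using left_inverse[OF False] by (simp only: shift_quadratic_scale q vec.scale_scale vec.scale_one)
        moreover have "inverse ?q *s e \<in> vec.span (eigenvectors A)"
          by (rule vec.span_scale[OF vec.span_base[OF e]])
        ultimately show ?thesis
          by (intro T_I[of e "inverse ?q *s e" 0])
            (simp_all only: eigen_shift_def vec.scale_zero_right matrix_vector_mult_0_right diff_self add_0_right)
      qed
    qed
    show "vec.subspace ?T"
    proof (rule vec.subspaceI)
      show "0 \<in> ?T"
        by (intro T_I[of 0 0 0]) (auto simp: shift_quadratic_def eigen_shift_def vec.span_zero)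
    next
      fix x y assume "x \<in> ?T" "y \<in> ?T"
      then obtain y1 w1 y2 w2 where *: "x = shift_quadratic A a c y1 + w1" "y = shift_quadratic A a c y2 + w2"
        "y1 \<in> vec.span (eigenvectors A)" "eigen_shift A a w1 = 0" "c *s w1 = 0"
        "y2 \<in> vec.span (eigenvectors A)" "eigen_shift A a w2 = 0" "c *s w2 = 0"
        by blast
      show "x + y \<in> ?T"
        using * by (intro T_I[of _ "y1 + y2" "w1 + w2"])
          (auto simp: shift_quadratic_add eigen_shift_add vec.span_add vec.scale_right_distrib)
    next
      fix r x assume "x \<in> ?T"
      then obtain y1 w1 where *: "x = shift_quadratic A a c y1 + w1"
        "y1 \<in> vec.span (eigenvectors A)" "eigen_shift A a w1 = 0" "c *s w1 = 0"
        by blast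
      have "c *s (r *s w1) = 0"
        using *(4) by (metis vec.scale_left_commute vec.scale_zero_right)
      with * show "r *s x \<in> ?T"
        by (intro T_I[of _ "r *s y1" "r *s w1"])
          (simp_all add: shift_quadratic_scale eigen_shift_scale vec.span_scale vec.scale_right_distrib)
    qed
  qed
  with u show ?thesis by blast
qed

text \<open>
  By the decomposition, \<open>u\<close> can be changed by an element \<open>y\<close> of the span so that \<open>z = u - y\<close> satisfies
  \<open>q(A) z = w\<close> with \<open>(A - a) w = 0\<close> and \<open>c w = 0\<close>. The absence of obstructions, applied first to \<open>(A - a) z\<close>,
  then makes \<open>z\<close> an eigenvector for \<open>a\<close>.
\<close>

lemma in_span_eigenvectors_of_quadratic:
  assumes A: "no_obstruction A" and c: "c \<in> C"
    and u: "shift_quadratic A a c u \<in> vec.span (eigenvectors A)"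
  shows "u \<in> vec.span (eigenvectors A)"
proof -
  obtain y w where y: "y \<in> vec.span (eigenvectors A)" and w: "eigen_shift A a w = 0" "c *s w = 0"
    and uyw: "shift_quadratic A a c u = shift_quadratic A a c y + w"
    using span_eigenvectors_decomposition[OF c u] by blast
  define z where "z = u - y"
  have z: "shift_quadratic A a c z = w"
    by (simp add: z_def shift_quadratic_diff uyw)
  have "shift_quadratic A a c (eigen_shift A a z) = 0"
    by (simp add: shift_quadratic_eigen_shift z w)
  then have sq: "eigen_shift A a (eigen_shift A a z) = 0"
    using A c by (auto simp: no_obstruction_def)
  then have "w = c *s z"
    using z by (simp add: shift_quadratic_def)
  \<comment> \<open>For \<open>c = 0\<close> the hypothesis on \<open>A\<close> applies to \<open>z\<close> once more; for \<open>c \<noteq> 0\<close> the identity \<open>w = c z\<close> forces \<open>z = 0\<close>.\<close>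
  have "eigen_shift A a z = 0"
  proof (cases "c = 0")
    case True
    then have "shift_quadratic A a c z = 0"
      by (simp add: shift_quadratic_def sq)
    then show ?thesis
      using A c by (auto simp: no_obstruction_def)
  next
    case False
    then have "z = 0"
      using \<open>w = c *s z\<close> w(2) by auto
    then show ?thesis by (simp add: eigen_shift_def)
  qed
  then have "z \<in> eigenvectors A"
    by (auto simp: eigenvectors_def eigen_shift_def)
  then have "y + z \<in> vec.span (eigenvectors A)"
    by (rule vec.span_add[OF y vec.span_base])
  then show ?thesis by (simp add: z_def)
qed

text \<open>
  Since the span is invariant under \<open>A - a\<close>, this is the previous lemma for \<open>q = (x - a)\<^sup>2\<close>.
\<close>

lemma in_span_eigenvectors_of_linear:
  assumes A: "no_obstruction A"
    and u: "eigen_shift A a u \<in> vec.span (eigenvectors A)"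
  shows "u \<in> vec.span (eigenvectors A)"
proof -
  have "eigen_shift A a (eigen_shift A a u) \<in> vec.span (eigenvectors A)"
    using u
  proof (induction rule: vec.span_induct_alt)
    case base
    show ?case by (simp add: eigen_shift_def vec.span_zero)
  next
    case (step r e y)
    then obtain \<mu> where "eigen_shift A a e = \<mu> *s e - a *s e"
      by (auto simp: eigenvectors_def eigen_shift_def)
    with step.hyps have "eigen_shift A a e \<in> vec.span (eigenvectors A)"
      by (simp add: vec.span_diff vec.span_scale vec.span_base)
    with step show ?case
      by (simp add: eigen_shift_add eigen_shift_scale vec.span_add vec.span_scale)
  qed
  then have "shift_quadratic A a 0 u \<in> vec.span (eigenvectors A)"
    by (simp add: shift_quadratic_def)
  then show ?thesis
    by (rule in_span_eigenvectors_of_quadratic[OF A zero_shift])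
qed

text \<open>
  Induction on the degree: if \<open>p = f * q\<close> with \<open>f\<close> linear or quadratic, the two preceding lemmas remove \<open>f\<close>,
  which leaves \<open>q(A) v\<close> in the span.
\<close>

lemma in_span_eigenvectors_of_poly_act:
  assumes A: "no_obstruction A" and "p \<noteq> 0" and "poly_act A p v \<in> vec.span (eigenvectors A)"
  shows "v \<in> vec.span (eigenvectors A)"
  using assms(2,3)
proof (induction "degree p" arbitrary: p rule: less_induct)
  case less
  show ?case
  proof (cases "degree p = 0")
    case True
    then obtain k where "p = [:k:]" by (auto elim: degree_eq_zeroE)
    with less.prems have "k \<noteq> 0" "k *s v \<in> vec.span (eigenvectors A)" by auto
    then have "k \<noteq> 0" "inverse k *s (k *s v) \<in> vec.span (eigenvectors A)"
      by (simp_all only: vec.span_scale not_False_eq_True)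
    then show ?thesis by simp
  next
    case False
    then consider a where "[:-a, 1:] dvd p"
      | a c where "c \<in> C" "[:a * a + c, - 2 * a, 1:] dvd p"
      using has_factor[of p] by blast
    then show ?thesis
    proof cases
      case 1
      then obtain q where p: "p = [:-a, 1:] * q" by (auto elim: dvdE)
      with less.prems have q: "q \<noteq> 0" "degree q < degree p" by (auto simp: degree_mult_eq simp del: mult_pCons_left)
      have "eigen_shift A a (poly_act A q v) \<in> vec.span (eigenvectors A)"
        using less.prems(2) by (simp only: p poly_act_mult poly_act_linear_factor)
      then show ?thesis
        using less.hyps q in_span_eigenvectors_of_linear[OF A] by blast
    next
      case 2
      then obtain q where p: "p = [:a * a + c, - 2 * a, 1:] * q" by (auto elim: dvdE)
      with less.prems have q: "q \<noteq> 0" "degree q < degree p" by (auto simp: degree_mult_eq simp del: mult_pCons_left)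
      have "shift_quadratic A a c (poly_act A q v) \<in> vec.span (eigenvectors A)"
        using less.prems(2) by (simp only: p poly_act_mult poly_act_quadratic_factor)
      then show ?thesis
        using less.hyps q in_span_eigenvectors_of_quadratic[OF A \<open>c \<in> C\<close>] by blast
    qed
  qed
qed


text \<open>
  In the coordinates that diagonalize \<open>A\<close>, the claim holds entry by entry, by definiteness.
\<close>

lemma no_obstruction_if_diagonalizable:
  fixes A :: "'f^'n^'n"
  assumes "diagonalizable A"
  shows "no_obstruction A"
  unfolding no_obstruction_def
proof (intro allI ballI impI)
  obtain P Q D :: "'f^'n^'n" where PQ: "P ** Q = mat 1"
    and "\<forall>i j. i \<noteq> j \<longrightarrow> D $ i $ j = 0" and A: "A = P ** D ** Q"
    using assms unfolding diagonalizable_iff_similar by blast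
  then have D: "D $ i $ j = 0" if "i \<noteq> j" for i j using that by blast
  have QP: "Q ** P = mat 1" using PQ by (metis matrix_left_right_inverse)
  have "Q ** A = D ** Q"
    by (simp add: A matrix_mul_assoc QP)
  then have comm: "Q *v (A *v v) = D *v (Q *v v)" for v
    by (simp add: matrix_vector_mul_assoc)
  have shift: "Q *v eigen_shift A a v = eigen_shift D a (Q *v v)" for a v
    by (simp add: eigen_shift_def matrix_vector_mult_diff_distrib comm vector_scalar_commute)
  have entry: "eigen_shift D a v $ i = (D $ i $ i - a) * v $ i" for a v i
  proof -
    have "(D *v v) $ i = (\<Sum>j\<in>UNIV. if j = i then D $ i $ i * v $ i else 0)"
      unfolding matrix_vector_mult_def vec_lambda_beta by (intro sum.cong) (auto simp: D)
    then show ?thesis by (simp add: eigen_shift_def algebra_simps)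
  qed
  fix a v c assume c: "c \<in> C" and v: "shift_quadratic A a c v = 0"
  have "Q *v shift_quadratic A a c v = 0" by (simp add: v)
  then have "eigen_shift D a (eigen_shift D a (Q *v v)) + c *s (Q *v v) = 0"
    by (simp add: shift_quadratic_def matrix_vector_right_distrib shift vector_scalar_commute)
  then have "((D $ i $ i - a) * (D $ i $ i - a) + c) * (Q *v v) $ i = 0" for i
    by (simp add: vec_eq_iff entry algebra_simps)
  then have "eigen_shift D a (Q *v v) $ i = 0" for i
    using definite[OF c] unfolding entry by (metis mult_eq_0_iff)
  then have "Q *v eigen_shift A a v = 0" by (simp add: shift vec_eq_iff)
  then have "P *v (Q *v eigen_shift A a v) = 0" by simp
  then show "eigen_shift A a v = 0" by (simp add: matrix_vector_mul_assoc PQ)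
qed

theorem diagonalizable_iff_no_obstruction: "diagonalizable A \<longleftrightarrow> no_obstruction A"
proof
  assume A: "no_obstruction A"
  have "v \<in> vec.span (eigenvectors A)" for v
  proof -
    obtain p where "p \<noteq> 0" "poly_act A p v = 0"
      using annihilating_poly_exists by blast
    then show ?thesis
      using in_span_eigenvectors_of_poly_act[OF A, of p v] by (simp add: vec.span_zero)
  qed
  then show "diagonalizable A"
    by (intro diagonalizable_if_eigenvectors_span) auto
qed (rule no_obstruction_if_diagonalizable)

end

lemma poly_of_real_eq:
  "poly (map_poly of_real p) (of_real x) = (of_real (poly p x) :: complex)"
  by (induction p) (simp_all add: map_poly_pCons)

lemma poly_map_of_real_add_mult:
  "poly (map_poly of_real (p * q + r)) (z :: complex) =
     poly (map_poly of_real p) z * poly (map_poly of_real q) z + poly (map_poly of_real r) z"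
proof -
  have smult: "poly (map_poly of_real (smult a q)) z = of_real a * poly (map_poly of_real q) z" for a and q
    by (induction q) (simp_all add: map_poly_pCons algebra_simps)
  have add: "poly (map_poly of_real (p + q)) z = poly (map_poly of_real p) z + poly (map_poly of_real q) z" for p q
    by (induction p q rule: poly_induct2) (simp_all add: map_poly_pCons algebra_simps)
  have "poly (map_poly of_real (p * q)) z = poly (map_poly of_real p) z * poly (map_poly of_real q) z"
    by (induction p) (simp_all add: add smult map_poly_pCons algebra_simps)
  then show ?thesis by (simp add: add)
qed

lemma definite_shifts_complex: "definite_shifts {0 :: complex}"
proof
  fix p :: "complex poly" assume "degree p > 0"
  then have "\<not> constant (poly p)" by (simp add: constant_degree)
  then obtain z where "poly p z = 0" using fundamental_theorem_of_algebra by blast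
  then have "[:-z, 1:] dvd p" by (simp add: poly_eq_0_iff_dvd)
  then show "(\<exists>a. [:-a, 1:] dvd p) \<or> (\<exists>a. \<exists>c\<in>{0}. [:a * a + c, - 2 * a, 1:] dvd p)" by blast
qed auto

text \<open>
  A complex root \<open>a + b \<i>\<close> of a real polynomial gives the real factor \<open>(x - a)\<^sup>2 + b\<^sup>2\<close> when \<open>b \<noteq> 0\<close>: the
  remainder modulo this quadratic has degree at most 1, real coefficients and a non-real root.
\<close>

lemma definite_shifts_real: "definite_shifts {0 :: real ..}"
proof
  fix c x :: real assume "c \<in> {0..}" "x * x + c = 0"
  then show "x = 0"
    by (metis add_nonneg_eq_0_iff atLeast_iff mult_eq_0_iff zero_le_square)
next
  fix p :: "real poly" assume "degree p > 0"
  let ?p = "map_poly of_real p :: complex poly"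
  have "\<not> constant (poly ?p)" using \<open>degree p > 0\<close> by (simp add: constant_degree degree_map_poly)
  then obtain z where z: "poly ?p z = 0" using fundamental_theorem_of_algebra by blast
  define a where "a = Re z"
  define b where "b = Im z"
  have z_eq: "z = Complex a b" by (simp add: a_def b_def)
  show "(\<exists>a. [:-a, 1:] dvd p) \<or> (\<exists>a. \<exists>c\<in>{0..}. [:a * a + c, - 2 * a, 1:] dvd p)"
  proof (cases "b = 0")
    case True
    then have "z = of_real a" by (simp add: z_eq complex_eq_iff)
    then have "poly p a = 0" using z poly_of_real_eq[of p a] by simp
    then show ?thesis by (auto simp: poly_eq_0_iff_dvd)
  next
    case False
    let ?q = "[:a * a + b * b, - 2 * a, 1:]"
    define r where "r = p mod ?q"
    have p: "p = ?q * (p div ?q) + r"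
      unfolding r_def by (rule mult_div_mod_eq[symmetric])
    have "r = 0 \<or> degree r < 2"
      using degree_mod_less[of ?q p] by (simp add: r_def numeral_2_eq_2)
    then have "degree r \<le> 1" by (auto simp: numeral_2_eq_2)
    then obtain r0 r1 where r: "r = [:r0, r1:]"
      by (metis One_nat_def degree_0 degree_pCons_eq_if degree_eq_zeroE le_zero_eq not_less_eq_eq pCons_cases)
    have "poly (map_poly of_real ?q) z = 0"
      by (simp add: z_eq map_poly_pCons complex_eq_iff algebra_simps)
    then have "poly (map_poly of_real r) z = 0"
      using z poly_map_of_real_add_mult[of ?q "p div ?q" r z] by (simp only: p[symmetric]) simp
    then have "r1 * b = 0" "r0 + r1 * a = 0"
      by (auto simp: r map_poly_pCons z_eq complex_eq_iff algebra_simps)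
    then have "r = 0" using False by (simp add: r)
    then have "?q dvd p" by (simp add: r_def dvd_eq_mod_eq_0)
    then show ?thesis by (intro disjI2 exI[of _ a] bexI[of _ "b * b"]) auto
  qed
qed auto

section \<open>Diagonalizable and non-diagonalizable matrices as increasing unions of closed sets\<close>

text \<open>
  Exhaust the closed set by its compact intersections with balls; continuous images of compact sets are compact.
\<close>

lemma projection_of_closed_is_increasing_union:
  fixes C :: "('a::euclidean_space \<times> 'b::euclidean_space) set"
  assumes "closed C"
  obtains K where "incseq K" "\<And>k. closed (K k)" "(\<Union>k. K k) = fst ` C"
proof
  let ?K = "\<lambda>k::nat. fst ` (C \<inter> cball 0 (real k))"
  show "incseq ?K"
    by (auto simp: incseq_def intro!: image_mono)
  show "closed (?K k)" for k
    by (intro compact_imp_closed compact_continuous_image continuous_intros)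
       (auto intro: closed_Int_compact assms)
  have "(\<Union>k. C \<inter> cball 0 (real k)) = C"
    using real_arch_simple by auto
  then show "(\<Union>k. ?K k) = fst ` C" by (metis image_UN)
qed

definition embed_matrix :: "real^'n^'n \<Rightarrow> 'f::real_field^'n^'n" where
  "embed_matrix A = (\<chi> i j. of_real (A $ i $ j))"

lemma diagonalizable_matrices_eq:
  "diagonalizable_matrices TYPE('f::real_field) =
     {A. diagonalizable (embed_matrix A :: 'f^'n^'n)}"
  by (simp add: diagonalizable_matrices_def diagonalizable_def embed_matrix_def)

lemma continuous_on_matrix_mult [continuous_intros]:
  fixes f :: "'a::topological_space \<Rightarrow> 'f::real_normed_field^'n^'n"
  assumes "continuous_on S f" "continuous_on S g"
  shows "continuous_on S (\<lambda>x. f x ** g x)"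
  unfolding matrix_matrix_mult_def by (intro continuous_intros assms)

lemma continuous_on_matrix_vector_mult [continuous_intros]:
  fixes f :: "'a::topological_space \<Rightarrow> 'f::real_normed_field^'n^'n"
  assumes "continuous_on S f" "continuous_on S g"
  shows "continuous_on S (\<lambda>x. f x *v g x)"
  unfolding matrix_vector_mult_def by (intro continuous_intros assms)

lemma continuous_on_scale_vec [continuous_intros]:
  fixes f :: "'a::topological_space \<Rightarrow> 'f::real_normed_field"
  assumes "continuous_on S f" "continuous_on S g"
  shows "continuous_on S (\<lambda>x. f x *s g x)"
  unfolding vector_scalar_mult_def by (intro continuous_intros assms)

lemma continuous_on_embed_matrix [continuous_intros]:
  fixes f :: "'a::topological_space \<Rightarrow> real^'n^'n"
  assumes "continuous_on S f"
  shows "continuous_on S (\<lambda>x. embed_matrix (f x) :: 'f::real_normed_field^'n^'n)"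
  unfolding embed_matrix_def by (intro continuous_intros assms)

lemma fst_image_Collect: "fst ` Collect (case_prod P) = {x. Ex (P x)}"
  by force

lemma diagonalizable_increasing_union:
  obtains K where "incseq K" "\<And>k. closed (K k)"
    "(\<Union>k. K k) = {A :: real^'n^'n. diagonalizable (embed_matrix A ::
       'f::{real_normed_field, euclidean_space}^'n^'n)}"
proof -
  let ?C = "{(A :: real^'n^'n, P :: 'f^'n^'n, Q :: 'f^'n^'n, D :: 'f^'n^'n).
    P ** Q = mat 1 \<and> (\<forall>i j. i \<noteq> j \<longrightarrow> D $ i $ j = 0) \<and> embed_matrix A = P ** D ** Q}"
  have diag: "closed {p :: (real^'n^'n) \<times> ('f^'n^'n) \<times> ('f^'n^'n) \<times> ('f^'n^'n). i \<noteq> j \<longrightarrow> snd (snd (snd p)) $ i $ j = 0}" for i j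
    by (cases "i = j") (auto intro!: closed_Collect_eq continuous_intros)
  have inv: "closed {p :: (real^'n^'n) \<times> ('f^'n^'n) \<times> ('f^'n^'n) \<times> ('f^'n^'n). fst (snd p) ** fst (snd (snd p)) = mat 1}"
    by (intro closed_Collect_eq continuous_intros)
  have eq: "closed {p :: (real^'n^'n) \<times> ('f^'n^'n) \<times> ('f^'n^'n) \<times> ('f^'n^'n). embed_matrix (fst p) = fst (snd p) ** snd (snd (snd p)) ** fst (snd (snd p))}"
    by (intro closed_Collect_eq continuous_intros)
  have "closed ?C"
    unfolding case_prod_beta
    by (intro closed_Collect_conj closed_Collect_all diag inv eq)
  moreover have "fst ` ?C = {A. diagonalizable (embed_matrix A :: 'f^'n^'n)}"
    by (simp add: fst_image_Collect split_paired_Ex diagonalizable_iff_similar)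
  ultimately show ?thesis
    using projection_of_closed_is_increasing_union[of ?C thesis] that by (simp only:)
qed

text \<open>
  An obstruction is a tuple \<open>(a, c, v)\<close>. The open condition \<open>(A - a) v \<noteq> 0\<close> is made closed by adding an
  inverse \<open>t\<close> of the norm as a further coordinate.
\<close>

lemma not_diagonalizable_increasing_union:
  fixes C :: "'f::{real_normed_field, euclidean_space} set"
  assumes C: "definite_shifts C" "closed C"
  obtains L where "incseq L" "\<And>k. closed (L k)"
    "(\<Union>k. L k) = - {A :: real^'n^'n. diagonalizable (embed_matrix A :: 'f^'n^'n)}"
proof -
  let ?C = "{(A :: real^'n^'n, a :: 'f, c :: 'f, v :: 'f^'n, t :: real). c \<in> C \<and>
    shift_quadratic (embed_matrix A) a c v = 0 \<and> t * norm (eigen_shift (embed_matrix A) a v) = 1}"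
  have "closed {p :: (real^'n^'n) \<times> 'f \<times> 'f \<times> ('f^'n) \<times> real. fst (snd (snd p)) \<in> C}"
    using continuous_closed_vimage[OF C(2), of "\<lambda>p :: (real^'n^'n) \<times> 'f \<times> 'f \<times> ('f^'n) \<times> real. fst (snd (snd p))"]
    by (simp add: vimage_def continuous_intros)
  then have "closed ?C"
    unfolding case_prod_beta shift_quadratic_def eigen_shift_def
    by (intro closed_Collect_conj closed_Collect_eq continuous_intros)
  moreover have "fst ` ?C = - {A. diagonalizable (embed_matrix A :: 'f^'n^'n)}"
  proof -
    have *: "\<not> diagonalizable (embed_matrix A :: 'f^'n^'n) \<longleftrightarrow>
      (\<exists>a c v. c \<in> C \<and> shift_quadratic (embed_matrix A) a c v = 0 \<and> eigen_shift (embed_matrix A) a v \<noteq> 0)"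
      for A :: "real^'n^'n"
      unfolding definite_shifts.diagonalizable_iff_no_obstruction[OF C(1)]
        definite_shifts.no_obstruction_def[OF C(1)] by blast
    have **: "x \<noteq> 0 \<longleftrightarrow> (\<exists>t::real. t * norm x = 1)" for x :: "'f^'n"
      by (metis mult_zero_right nonzero_inverse_mult_distrib left_inverse norm_eq_zero zero_neq_one)
    show ?thesis
      unfolding Collect_neg_eq[symmetric] * **
      by (auto simp: fst_image_Collect split_paired_Ex)
  qed
  ultimately show ?thesis
    using projection_of_closed_is_increasing_union[of ?C thesis] that by (simp only:)
qed

section \<open>Deciding membership of a limit in a set of this kind\<close>

text \<open>
  Using open balls keeps every thickening open, hence Borel, for arbitrary \<open>K\<close>.
\<close>

definition thickening :: "real \<Rightarrow> 'a::metric_space set \<Rightarrow> 'a set" where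
  "thickening r K = (\<Union>y\<in>K. ball y r)"

lemma thickening_mono: "K \<subseteq> L \<Longrightarrow> thickening r K \<subseteq> thickening r L"
  by (auto simp: thickening_def)

lemma thickening_borel [measurable]: "thickening r K \<in> sets borel"
  by (simp add: thickening_def open_UN)

lemma eventually_notin_thickening:
  fixes K :: "'a::metric_space set"
  assumes K: "closed K" "M \<notin> K" and r: "r \<longlonglongrightarrow> 0" and close: "\<forall>\<^sub>F N in sequentially. dist (m N) M < r N"
  shows "\<forall>\<^sub>F N in sequentially. m N \<notin> thickening (r N) K"
proof -
  have "open (- K)" "M \<in> - K" using K by auto
  then obtain e where e: "e > 0" "ball M e \<subseteq> - K"
    using open_contains_ball by blast
  have "\<forall>\<^sub>F N in sequentially. r N < e / 2"
    using r e(1) by (intro order_tendstoD(2)[OF r]) auto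
  with close show ?thesis
  proof eventually_elim
    case (elim N)
    show ?case
    proof
      assume "m N \<in> thickening (r N) K"
      then obtain y where y: "y \<in> K" "dist y (m N) < r N" by (auto simp: thickening_def)
      then have "dist M y < e"
        using elim dist_triangle[of M y "m N"] by (simp add: dist_commute)
      with e(2) y(1) show False by auto
    qed
  qed
qed

definition closeness_rule ::
  "(nat \<Rightarrow> real) \<Rightarrow> (nat \<Rightarrow> 'a::metric_space set) \<Rightarrow> (nat \<Rightarrow> 'a set) \<Rightarrow> nat \<Rightarrow> 'a \<Rightarrow> bool" where
  "closeness_rule r K L N m \<longleftrightarrow> (\<exists>k. m \<in> thickening (r N) (K k) \<and> m \<notin> thickening (r N) (L k))"

text \<open>
  Let \<open>M\<close> be the limit of \<open>m\<close>. A closed set that misses \<open>M\<close> is eventually out of reach of \<open>m N\<close>, while a set that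
  contains \<open>M\<close> is eventually within reach. If \<open>M \<in> S\<close>, any \<open>k\<close> with \<open>M \<in> K k\<close> becomes a witness. If \<open>M \<in> L k\<close>,
  monotonicity of \<open>K\<close> excludes all witnesses up to \<open>k\<close> at once, and monotonicity of \<open>L\<close> those beyond.
\<close>

lemma closeness_rule_eventually_correct:
  fixes K L :: "nat \<Rightarrow> 'a::metric_space set"
  assumes K: "incseq K" "\<And>k. closed (K k)" "(\<Union>k. K k) = S"
    and L: "incseq L" "\<And>k. closed (L k)" "(\<Union>k. L k) = - S"
    and r: "r \<longlonglongrightarrow> 0" and close: "\<forall>\<^sub>F N in sequentially. dist (m N) M < r N"
  shows "\<forall>\<^sub>F N in sequentially. closeness_rule r K L N (m N) \<longleftrightarrow> M \<in> S"
proof (cases "M \<in> S")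
  case True
  then obtain k where k: "M \<in> K k" using K(3) by blast
  have "M \<notin> L k" using True L(3) by blast
  from eventually_notin_thickening[OF L(2) this r close] close show ?thesis
  proof eventually_elim
    case (elim N)
    then show ?case
      using True k by (auto simp: closeness_rule_def thickening_def dist_commute)
  qed
next
  case False
  then obtain k where k: "M \<in> L k" using L(3) by blast
  have "M \<notin> K k" using False K(3) by blast
  from eventually_notin_thickening[OF K(2) this r close] close show ?thesis
  proof eventually_elim
    case (elim N)
    \<comment> \<open>No index \<open>j\<close> is a witness: for \<open>j \<le> k\<close> the sample is far from \<open>K j\<close>, for \<open>j > k\<close> it is close to \<open>L j\<close>.\<close>
    have "m N \<in> thickening (r N) (L j)" if "m N \<in> thickening (r N) (K j)" for j
    proof (cases "j \<le> k")
      case True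
      then have "thickening (r N) (K j) \<subseteq> thickening (r N) (K k)"
        using K(1) by (intro thickening_mono) (auto simp: incseq_def)
      with that elim(1) show ?thesis by blast
    next
      case False
      then have "M \<in> L j" using k L(1) by (meson incseq_def nle_le subsetD)
      with elim(2) show ?thesis by (auto simp: thickening_def dist_commute)
    qed
    with False show ?case by (auto simp: closeness_rule_def)
  qed
qed

section \<open>Almost sure convergence of sample means at a known rate\<close>

definition sample_mean :: "nat \<Rightarrow> (nat \<Rightarrow> 'a::real_vector) \<Rightarrow> 'a" where
  "sample_mean N x = (1 / real N) *\<^sub>R (\<Sum>i<N. x i)"

text \<open>
  The exponent lies strictly between \<open>- 1/2\<close> and 0: the radius tends to 0, and Hoeffding's bound for a deviation
  of \<open>c * radius N\<close>, which is \<open>2 * exp (- 2 * c\<^sup>2 * N powr (1/2))\<close>, is summable.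
\<close>

definition radius :: "nat \<Rightarrow> real" where "radius N = real N powr (- (1/4))"

lemma radius_tendsto_0: "radius \<longlonglongrightarrow> 0"
  unfolding radius_def by real_asymp

lemma summable_exp_minus_sqrt: 
  assumes "c > 0" shows "summable (\<lambda>N. 2 * exp (- c * real N powr (1/2)))"
proof (rule summable_comparison_test_bigo)
  show "summable (\<lambda>N. norm (1 / real N ^ 2))"
    using inverse_power_summable[of 2, where 'a=real] by (simp add: field_simps)
  show "(\<lambda>N. 2 * exp (- c * real N powr (1/2))) \<in> O(\<lambda>N. 1 / real N ^ 2)"
    using assms by real_asymp
qed

text \<open>
  Hoeffding's inequality bounds the probability of each deviation by a summable sequence, so the
  Borel-Cantelli lemma applies.
\<close>

lemma (in prob_space) iid_unit_interval_mean_concentration: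
  fixes Y :: "nat \<Rightarrow> 'a \<Rightarrow> real"
  assumes indep: "indep_vars (\<lambda>_. borel) Y UNIV"
    and distr: "\<And>i. distr M borel (Y i) = distr M borel (Y 0)"
    and bdd: "AE \<omega> in M. Y 0 \<omega> \<in> {0..1}" and c: "c > 0"
  shows "AE \<omega> in M. \<forall>\<^sub>F N in sequentially.
    \<bar>sample_mean N (\<lambda>i. Y i \<omega>) - expectation (Y 0)\<bar> < c * radius N"
proof -
  have [measurable]: "random_variable borel (Y i)" for i
    using indep by (auto simp: indep_vars_def)
  define A where "A N = {\<omega>\<in>space M. \<bar>sample_mean N (\<lambda>i. Y i \<omega>) - expectation (Y 0)\<bar> \<ge> c * radius N}" for N
  have [measurable]: "A N \<in> sets M" for N
    unfolding A_def sample_mean_def by measurable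
  have "prob (A N) \<le> 2 * exp (- (2 * c ^ 2) * real N powr (1/2))" for N
  proof (cases "N = 0")
    case True
    then show ?thesis using prob_le_1[of "A N"] by (simp del: prob_le_1)
  next
    case False
    have rN: "real N * radius N = real N powr (3/4)"
      using powr_add[of "real N" 1 "-(1/4)"] by (simp add: radius_def)
    define e where "e = c * (real N * radius N)"
    have "e \<ge> 0" using c by (simp add: e_def radius_def)
    have "A N = {\<omega>\<in>space M. \<bar>(\<Sum>i<N. Y i \<omega>) - real (card {..<N}) * expectation (Y 0)\<bar> \<ge> e}"
    proof -
      have "(c * radius N \<le> \<bar>s / real N - e\<bar>) \<longleftrightarrow> (c * (real N * radius N) \<le> \<bar>s - real N * e\<bar>)" for s e
      proof -
        have "s - real N * e = (s / real N - e) * real N"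
          using False by (simp add: field_simps)
        then have "\<bar>s - real N * e\<bar> = \<bar>s / real N - e\<bar> * real N"
          by (simp only: abs_mult abs_of_nat)
        then show ?thesis using False by (simp add: field_simps)
      qed
      then show ?thesis by (simp add: A_def sample_mean_def e_def)
    qed
    moreover have "prob {\<omega>\<in>space M. \<bar>(\<Sum>i<N. Y i \<omega>) - real (card {..<N}) * expectation (Y 0)\<bar> \<ge> e}
        \<le> 2 * exp (-2 * e\<^sup>2 / (real (card {..<N}) * (1 - 0)\<^sup>2))"
    proof -
      interpret Hoeffding_ineq_iid M "{..<N}" Y "Y 0" 0 1 "expectation (Y 0)"
        using distr bdd by unfold_locales (auto intro: indep_vars_subset[OF indep])
      show ?thesis
        using False by (intro Hoeffding_ineq_abs_ge \<open>e \<ge> 0\<close>) auto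
    qed
    ultimately have "prob (A N) \<le> 2 * exp (-2 * e\<^sup>2 / (real (card {..<N}) * (1 - 0)\<^sup>2))"
      by (simp only:)
    also have "-2 * e\<^sup>2 / (real (card {..<N}) * (1 - 0)\<^sup>2) =
        - (2 * c ^ 2) * real N powr (1/2)"
    proof -
      have "(real N powr (3/4))\<^sup>2 = real N powr (1/2) * real N"
        using powr_add[of "real N" "3/4" "3/4"] powr_add[of "real N" "1/2" 1]
        by (simp add: power2_eq_square)
      then have "e\<^sup>2 = c\<^sup>2 * (real N powr (1/2) * real N)"
        by (simp only: e_def rN power_mult_distrib)
      then show ?thesis using False by simp
    qed
    finally show ?thesis .
  qed
  then have "summable (\<lambda>N. prob (A N))"
    using c by (intro summable_comparison_test'[OF summable_exp_minus_sqrt[of "2 * c ^ 2"], of 0]) auto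
  then have "AE \<omega> in M. \<forall>\<^sub>F N in sequentially. \<omega> \<in> space M - A N"
    by (intro borel_cantelli_AE1) (auto simp: emeasure_eq_measure)
  then show ?thesis
    by eventually_elim (auto simp: A_def elim!: eventually_mono)
qed

section \<open>The prediction rules\<close>

definition mean_rule ::
  "(nat \<Rightarrow> (real^'n^'n) set) \<Rightarrow> (nat \<Rightarrow> (real^'n^'n) set) \<Rightarrow> nat \<Rightarrow> (nat \<Rightarrow> real^'n^'n) \<Rightarrow> nat" where
  "mean_rule K L N x = of_bool (closeness_rule radius K L N (sample_mean N x))"

lemma closeness_rule_measurable [measurable]:
  "Measurable.pred borel (closeness_rule r K L N)"
  unfolding closeness_rule_def by measurable

lemma borel_prediction_rules_mean_rule: "borel_prediction_rules (mean_rule K L)"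
proof -
  have [measurable]: "sample_mean N \<in> borel_measurable (\<Pi>\<^sub>M i\<in>{..<N}. borel :: (real^'n^'n) measure)" for N
    unfolding sample_mean_def by measurable
  show ?thesis
    unfolding borel_prediction_rules_def mean_rule_def of_bool_def by measurable
qed

text \<open>
  Concentration is proved for each entry separately; this bound turns it into concentration of the matrix.
\<close>

lemma norm_matrix_less:
  fixes B :: "real^'n^'n"
  assumes "\<And>i j. \<bar>B $ i $ j\<bar> < 1 / (real CARD('n) * real CARD('n)) * r"
  shows "norm B < r"
proof -
  have "norm B \<le> (\<Sum>i\<in>UNIV. norm (B $ i))"
    unfolding norm_vec_def by (intro L2_set_le_sum) auto
  also have "\<dots> \<le> (\<Sum>i\<in>UNIV. \<Sum>j\<in>UNIV. \<bar>B $ i $ j\<bar>)"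
    by (intro sum_mono norm_le_l1_cart)
  also have "\<dots> < (\<Sum>i\<in>(UNIV :: 'n set). \<Sum>j\<in>(UNIV :: 'n set). 1 / (real CARD('n) * real CARD('n)) * r)"
    by (intro sum_strict_mono assms) auto
  also have "\<dots> = r" by simp
  finally show ?thesis .
qed

text \<open>
  For fixed \<open>i\<close> and \<open>j\<close> the entries at position \<open>(i, j)\<close> are i.i.d. along the sequence, and finitely many almost
  sure events have an almost sure intersection, however the entries of one matrix depend on each other.
\<close>

lemma sample_mean_converges:
  fixes X :: "nat \<Rightarrow> 'w \<Rightarrow> real^'n^'n"
  assumes iid: "iid_with_law \<Omega> X \<mu>" and \<mu>: "AE A in \<mu>. A \<in> entries_in {0..1}"
  shows "AE \<omega> in \<Omega>. \<forall>\<^sub>F N in sequentially.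
    dist (sample_mean N (\<lambda>i. X i \<omega>)) (entrywise_mean \<Omega> (X 0)) < radius N"
proof -
  interpret prob_space \<Omega> using iid by (simp add: iid_with_law_def)
  have indep: "indep_vars (\<lambda>_. borel) X UNIV" and law: "\<And>k. distr \<Omega> borel (X k) = \<mu>"
    using iid by (auto simp: iid_with_law_def)
  have [measurable]: "random_variable borel (X k)" for k
    using indep by (auto simp: indep_vars_def)
  have entry [measurable]: "(\<lambda>A. A $ i $ j) \<in> borel_measurable borel" for i j :: 'n
    by (intro borel_measurable_continuous_onI continuous_intros)
  let ?c = "1 / (real CARD('n) * real CARD('n))"
  have "AE \<omega> in \<Omega>. \<forall>\<^sub>F N in sequentially.
      \<bar>sample_mean N (\<lambda>k. X k \<omega> $ i $ j) - expectation (\<lambda>\<omega>. X 0 \<omega> $ i $ j)\<bar> < ?c * radius N" for i j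
  proof (rule iid_unit_interval_mean_concentration)
    show "indep_vars (\<lambda>_. borel) (\<lambda>k \<omega>. X k \<omega> $ i $ j) UNIV"
      by (rule indep_vars_compose2[OF indep]) measurable
    have "distr \<Omega> borel (\<lambda>\<omega>. X k \<omega> $ i $ j) = distr \<mu> borel (\<lambda>A. A $ i $ j)" for k
      by (simp add: law[of k, symmetric] distr_distr comp_def)
    then show "distr \<Omega> borel (\<lambda>\<omega>. X k \<omega> $ i $ j) = distr \<Omega> borel (\<lambda>\<omega>. X 0 \<omega> $ i $ j)" for k
      by simp
    have "AE A in distr \<Omega> borel (X 0). A $ i $ j \<in> {0..1}"
      using \<mu> unfolding law by eventually_elim (auto simp: entries_in_def)
    then show "AE \<omega> in \<Omega>. X 0 \<omega> $ i $ j \<in> {0..1}"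
      by (subst (asm) AE_distr_iff) auto
  qed auto
  then have "AE \<omega> in \<Omega>. \<forall>i j. \<forall>\<^sub>F N in sequentially.
      \<bar>sample_mean N (\<lambda>k. X k \<omega> $ i $ j) - expectation (\<lambda>\<omega>. X 0 \<omega> $ i $ j)\<bar> < ?c * radius N"
    by (intro AE_finite_allI AE_all_countable[THEN iffD2] allI) auto
  then show ?thesis
  proof eventually_elim
    case (elim \<omega>)
    then have "\<forall>\<^sub>F N in sequentially. \<forall>i j.
        \<bar>sample_mean N (\<lambda>k. X k \<omega> $ i $ j) - expectation (\<lambda>\<omega>. X 0 \<omega> $ i $ j)\<bar> < ?c * radius N"
      by (intro eventually_all_finite allI) auto
    then show ?case
    proof eventually_elim
      case (elim N)
      have "(sample_mean N (\<lambda>k. X k \<omega>) - entrywise_mean \<Omega> (X 0)) $ i $ j =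
          sample_mean N (\<lambda>k. X k \<omega> $ i $ j) - expectation (\<lambda>\<omega>. X 0 \<omega> $ i $ j)" for i j
        by (simp add: sample_mean_def entrywise_mean_def)
      with elim show ?case
        by (auto simp: dist_norm intro!: norm_matrix_less)
    qed
  qed
qed

lemma eventually_correct_mean_rule:
  fixes X :: "nat \<Rightarrow> 'w \<Rightarrow> real^'n^'n"
  assumes K: "incseq K" "\<And>k. closed (K k)" "(\<Union>k. K k) = S"
    and L: "incseq L" "\<And>k. closed (L k)" "(\<Union>k. L k) = - S"
    and iid: "iid_with_law \<Omega> X \<mu>" and \<mu>: "AE A in \<mu>. A \<in> entries_in {0..1}"
  shows "eventually_correct S (mean_rule K L) \<Omega> X"
proof -
  interpret prob_space \<Omega> using iid by (simp add: iid_with_law_def)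
  have [measurable]: "random_variable borel (X k)" for k
    using iid by (auto simp: iid_with_law_def indep_vars_def)
  let ?M = "entrywise_mean \<Omega> (X 0)"
  have rule: "mean_rule K L N (\<lambda>i\<in>{..<N}. X i \<omega>) = of_bool (?M \<in> S) \<longleftrightarrow>
      (closeness_rule radius K L N (sample_mean N (\<lambda>i. X i \<omega>)) \<longleftrightarrow> ?M \<in> S)" for N \<omega>
    by (simp add: mean_rule_def sample_mean_def)
  have "AE \<omega> in \<Omega>. \<forall>\<^sub>F N in sequentially.
      closeness_rule radius K L N (sample_mean N (\<lambda>i. X i \<omega>)) \<longleftrightarrow> ?M \<in> S"
    using sample_mean_converges[OF iid \<mu>]
    by eventually_elim (rule closeness_rule_eventually_correct[OF K L radius_tendsto_0])
  moreover have "{\<omega>\<in>space \<Omega>. \<forall>\<^sub>F N in sequentially.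
      closeness_rule radius K L N (sample_mean N (\<lambda>i. X i \<omega>)) \<longleftrightarrow> ?M \<in> S} \<in> events"
    unfolding eventually_sequentially sample_mean_def by measurable
  ultimately show ?thesis
    unfolding eventually_correct_def rule by (subst prob_Collect_eq_1)
qed

lemma iid_with_law_coordinates:
  fixes \<mu> :: "(real^'n^'n) measure"
  assumes "prob_space \<mu>" "sets \<mu> = sets borel"
  shows "iid_with_law (\<Pi>\<^sub>M i\<in>(UNIV :: nat set). \<mu>) (\<lambda>i x. x i) \<mu>"
proof -
  interpret P: prob_space "\<Pi>\<^sub>M i\<in>(UNIV :: nat set). \<mu>"
    by (rule prob_space_PiM) (rule assms)
  have sets: "sets (\<Pi>\<^sub>M i\<in>(UNIV :: nat set). \<mu>) = sets (\<Pi>\<^sub>M i\<in>UNIV. borel)"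
    by (intro sets_PiM_cong) (auto simp: assms)
  have law: "distr (\<Pi>\<^sub>M i\<in>(UNIV :: nat set). \<mu>) borel (\<lambda>x. x k) = \<mu>" for k
    using distr_PiM_component[of UNIV "\<lambda>_. \<mu>" k] assms by (simp cong: distr_cong)
  have [measurable]: "P.random_variable borel (\<lambda>x. x k)" for k
    by (subst measurable_cong_sets[OF sets refl]) measurable
  have "P.indep_vars (\<lambda>_. borel) (\<lambda>i x. x i) UNIV"
    by (subst P.indep_vars_iff_distr_eq_PiM')
       (auto simp: law intro!: trans[OF distr_cong[OF refl sets[symmetric]] distr_id2])
  then show ?thesis
    by (simp add: iid_with_law_def P.prob_space_axioms law)
qed

lemma law_of_iid:
  fixes X :: "nat \<Rightarrow> 'w \<Rightarrow> real^'n^'n"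
  assumes iid: "iid_with_law \<Omega> X \<mu>" and E: "E \<in> sets borel" and AE: "AE \<omega> in \<Omega>. X 0 \<omega> \<in> E"
  shows "AE A in \<mu>. A \<in> E"
proof -
  interpret prob_space \<Omega> using iid by (simp add: iid_with_law_def)
  have X0: "random_variable borel (X 0)" and law: "distr \<Omega> borel (X 0) = \<mu>"
    using iid by (auto simp: iid_with_law_def indep_vars_def)
  have "AE A in distr \<Omega> borel (X 0). A \<in> E"
    using AE E by (subst AE_distr_iff[OF X0]) auto
  then show ?thesis by (simp only: law)
qed

theorem theorem2p2:
  fixes S :: "(real^'d^'d) set"
  assumes "S \<in> {diagonalizable_matrices TYPE(real), diagonalizable_matrices TYPE(complex)}"
  shows "\<exists>\<Phi>. borel_prediction_rules \<Phi> \<and>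
    (\<forall>\<mu> :: (real^'d^'d) measure.
       prob_space \<mu> \<and> sets \<mu> = sets borel \<and> (AE A in \<mu>. A \<in> entries_in {0..1}) \<longrightarrow>
         eventually_correct S \<Phi> (\<Pi>\<^sub>M i\<in>(UNIV :: nat set). \<mu>) (\<lambda>i x. x i) \<and>
         (\<forall>(\<Omega> :: 'w measure) X. iid_with_law \<Omega> X \<mu> \<longrightarrow> eventually_correct S \<Phi> \<Omega> X)) \<and>
    (\<forall>(\<Omega> :: 'w measure) X \<mu>.
       iid_with_law \<Omega> X \<mu> \<and> (AE \<omega> in \<Omega>. X 0 \<omega> \<in> entries_in {0, 1}) \<longrightarrow>
         eventually_correct S \<Phi> \<Omega> X)"
proof -
  obtain K L where KL: "incseq K" "\<And>k. closed (K k)" "(\<Union>k. K k) = S"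
    "incseq L" "\<And>k. closed (L k)" "(\<Union>k. L k) = - S"
    using assms
  proof (elim insertE emptyE)
    assume S: "S = diagonalizable_matrices TYPE(real)"
    obtain K where "incseq K" "\<And>k. closed (K k)" "(\<Union>k. K k) = S"
      using diagonalizable_increasing_union[where 'f = real and 'n = 'd]
      unfolding S diagonalizable_matrices_eq by blast
    moreover obtain L where "incseq L" "\<And>k. closed (L k)" "(\<Union>k. L k) = - S"
      using not_diagonalizable_increasing_union[where 'n = 'd, OF definite_shifts_real]
      unfolding S diagonalizable_matrices_eq by auto
    ultimately show ?thesis by (rule that)
  next
    assume S: "S = diagonalizable_matrices TYPE(complex)"
    obtain K where "incseq K" "\<And>k. closed (K k)" "(\<Union>k. K k) = S"
      using diagonalizable_increasing_union[where 'f = complex and 'n = 'd]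
      unfolding S diagonalizable_matrices_eq by blast
    moreover obtain L where "incseq L" "\<And>k. closed (L k)" "(\<Union>k. L k) = - S"
      using not_diagonalizable_increasing_union[where 'n = 'd, OF definite_shifts_complex]
      unfolding S diagonalizable_matrices_eq by auto
    ultimately show ?thesis by (rule that)
  qed
  note correct = eventually_correct_mean_rule[OF KL]
  have "eventually_correct S (mean_rule K L) \<Omega> X"
    if "iid_with_law \<Omega> X \<mu>" "AE \<omega> in \<Omega>. X 0 \<omega> \<in> entries_in {0, 1}" for \<Omega> :: "'w measure" and X \<mu>
  proof (rule correct[OF that(1)])
    have "entries_in {0, 1} = (\<Inter>i. \<Inter>j. {A :: real^'d^'d. A $ i $ j = 0 \<or> A $ i $ j = 1})"
      by (auto simp: entries_in_def)
    also have "closed \<dots>"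
      by (intro closed_INT ballI closed_Collect_disj closed_Collect_eq continuous_intros)
    finally have "AE A in \<mu>. A \<in> entries_in {0, 1}"
      using law_of_iid[OF that(1) _ that(2)] by simp
    then show "AE A in \<mu>. A \<in> entries_in {0..1}"
    proof eventually_elim
      case (elim A)
      then have "A $ i $ j = 0 \<or> A $ i $ j = 1" for i j by (auto simp: entries_in_def)
      then have "0 \<le> A $ i $ j \<and> A $ i $ j \<le> 1" for i j
        by (metis order_refl zero_le_one)
      then show ?case by (simp add: entries_in_def)
    qed
  qed
  then show ?thesis
    using borel_prediction_rules_mean_rule[of K L] correct[OF iid_with_law_coordinates] correct
    by (intro exI[of _ "mean_rule K L"]) auto
qed

end
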